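(* Let $k$ be an infinite field of characteristic $p>0$ and let $S=k[x_1,x_2,\ldots]=\mathrm{Sym}(\mathbf{V})$ with its natural action of $\mathrm{GL}$. The $\mathrm{GL}$-prime ideals of $S$ are exactly the zero ideal $(0)$ and the ideals $\mathfrak{m}^{[p^r]}=(x_1^{p^r},x_2^{p^r},\ldots,x_n^{p^r},\ldots)$ for integers $r\ge 0$.
   Context: $\mathbf{V}$ is the $k$-vector space with basis $e_1,e_2,\ldots$, and $\mathrm{GL}$ is the group of automorphisms of $\mathbf{V}$ fixing all but finitely many of the $e_i$. $S=\mathrm{Sym}(\mathbf{V})$ is the polynomial ring in the variables $x_i$ (the images of the $e_i$), on which $\mathrm{GL}$ acts by $k$-algebra automorphisms extending its action on $\mathbf{V}$. A proper $\mathrm{GL}$-stable ideal $\mathfrak{p}\subset S$ is $\mathrm{GL}$-prime if for all $\mathrm{GL}$-stable ideals $\mathfrak{a},\mathfrak{b}$ of $S$ with $\mathfrak{a}\mathfrak{b}\subset\mathfrak{p}$, either $\mathfrak{a}\subset\mathfrak{p}$ or $\mathfrak{b}\subset\mathfrak{p}$. *)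

theory Defs
  imports "HOL-Library.Poly_Mapping" "HOL-Algebra.Ideal_Product"
    "HOL-Algebra.Algebraic_Closure_Type"
begin

text \<open>
  The basis vectors and the variables are indexed from 0 instead of 1.  A polynomial
  is a finitely supported function from monomials to coefficients, and a monomial is a finitely
  supported function from variables to exponents.
\<close>

type_synonym 'k fin_vec = "nat \<Rightarrow>\<^sub>0 'k"
type_synonym 'k inf_poly = "(nat \<Rightarrow>\<^sub>0 nat) \<Rightarrow>\<^sub>0 'k"

definition vec_scale :: "'k::field \<Rightarrow> 'k fin_vec \<Rightarrow> 'k fin_vec" where
  "vec_scale c v = Poly_Mapping.map ((*) c) v"

definition basis_vec :: "nat \<Rightarrow> 'k::field fin_vec" where
  "basis_vec i = Poly_Mapping.single i 1"

definition GL :: "('k::field fin_vec \<Rightarrow> 'k fin_vec) set" where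
  "GL = {g. Vector_Spaces.linear vec_scale vec_scale g \<and> bij g \<and>
            finite {i. g (basis_vec i) \<noteq> basis_vec i}}"

definition Const :: "'k::field \<Rightarrow> 'k inf_poly" where
  "Const c = Poly_Mapping.single 0 c"

definition Var :: "nat \<Rightarrow> 'k::field inf_poly" where
  "Var i = Poly_Mapping.single (Poly_Mapping.single i 1) 1"

definition linear_form :: "'k::field fin_vec \<Rightarrow> 'k inf_poly" where
  "linear_form v = (\<Sum>i\<in>Poly_Mapping.keys v. Const (Poly_Mapping.lookup v i) * Var i)"

text \<open>
  \<open>subst_poly \<sigma>\<close> replaces each variable \<open>Var i\<close> by \<open>\<sigma> i\<close>.  For \<open>g\<close> in \<open>GL\<close>, the lemmas below
  identify \<open>GL_act g\<close> as the only \<open>k\<close>-algebra endomorphism of the polynomial ring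
  that extends \<open>g\<close>, and show that it is bijective and compatible with composition.
\<close>

definition subst_monom :: "(nat \<Rightarrow> 'k::field inf_poly) \<Rightarrow> (nat \<Rightarrow>\<^sub>0 nat) \<Rightarrow> 'k inf_poly" where
  "subst_monom \<sigma> m = (\<Prod>i\<in>Poly_Mapping.keys m. \<sigma> i ^ Poly_Mapping.lookup m i)"

definition subst_poly :: "(nat \<Rightarrow> 'k::field inf_poly) \<Rightarrow> 'k inf_poly \<Rightarrow> 'k inf_poly" where
  "subst_poly \<sigma> f =
     (\<Sum>m\<in>Poly_Mapping.keys f. Const (Poly_Mapping.lookup f m) * subst_monom \<sigma> m)"

definition GL_act :: "('k::field fin_vec \<Rightarrow> 'k fin_vec) \<Rightarrow> 'k inf_poly \<Rightarrow> 'k inf_poly" where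
  "GL_act g = subst_poly (\<lambda>i. linear_form (g (basis_vec i)))"

abbreviation poly_ring :: "'k::field inf_poly ring" where
  "poly_ring \<equiv> ring_of_type_algebra"

definition GL_stable_ideal :: "'k::field inf_poly set \<Rightarrow> bool" where
  "GL_stable_ideal I \<longleftrightarrow> ideal I poly_ring \<and> (\<forall>g\<in>GL. \<forall>f\<in>I. GL_act g f \<in> I)"

definition GL_prime :: "'k::field inf_poly set \<Rightarrow> bool" where
  "GL_prime P \<longleftrightarrow> GL_stable_ideal P \<and> P \<noteq> UNIV \<and>
     (\<forall>A B. GL_stable_ideal A \<longrightarrow> GL_stable_ideal B \<longrightarrow> ideal_prod poly_ring A B \<subseteq> P \<longrightarrow>
        A \<subseteq> P \<or> B \<subseteq> P)"

definition frobenius_power_max_ideal :: "nat \<Rightarrow> 'k::field inf_poly set" where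
  "frobenius_power_max_ideal q = genideal poly_ring (range (\<lambda>i. Var i ^ q))"


lemma lookup_vec_scale: "Poly_Mapping.lookup (vec_scale c v) i = c * Poly_Mapping.lookup v i"
  unfolding vec_scale_def by (transfer) (auto simp: when_def)

lemma vector_space_vec_scale: "vector_space (vec_scale :: 'k::field \<Rightarrow> _)"
  by unfold_locales
    (auto intro!: poly_mapping_eqI simp: lookup_vec_scale lookup_add algebra_simps)

lemma Const_0 [simp]: "Const 0 = 0" and Const_1 [simp]: "Const 1 = 1"
  and Const_add: "Const (a + b) = Const a + Const b"
  and Const_mult: "Const (a * b) = Const a * Const b"
  by (simp_all add: Const_def single_add mult_single)

lemma subst_monom_superset:
  assumes "finite A" "Poly_Mapping.keys m \<subseteq> A"
  shows "subst_monom \<sigma> m = (\<Prod>i\<in>A. \<sigma> i ^ Poly_Mapping.lookup m i)"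
  unfolding subst_monom_def
  by (rule prod.mono_neutral_left) (use assms in \<open>auto simp: in_keys_iff\<close>)

lemma subst_monom_add: "subst_monom \<sigma> (m + n) = subst_monom \<sigma> m * subst_monom \<sigma> n"
proof -
  let ?A = "Poly_Mapping.keys m \<union> Poly_Mapping.keys n"
  have "Poly_Mapping.keys (m + n) \<subseteq> ?A"
    by (rule Poly_Mapping.keys_add)
  then have "subst_monom \<sigma> (m + n) = (\<Prod>i\<in>?A. \<sigma> i ^ Poly_Mapping.lookup (m + n) i)"
    by (intro subst_monom_superset) auto
  also have "\<dots> = subst_monom \<sigma> m * subst_monom \<sigma> n"
    by (simp add: subst_monom_superset[of ?A] lookup_add power_add prod.distrib)
  finally show ?thesis .
qed

lemma subst_poly_superset:
  assumes "finite A" "Poly_Mapping.keys f \<subseteq> A"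
  shows "subst_poly \<sigma> f = (\<Sum>m\<in>A. Const (Poly_Mapping.lookup f m) * subst_monom \<sigma> m)"
  unfolding subst_poly_def
  by (rule sum.mono_neutral_left) (use assms in \<open>auto simp: in_keys_iff\<close>)

lemma subst_poly_add: "subst_poly \<sigma> (f + g) = subst_poly \<sigma> f + subst_poly \<sigma> g"
proof -
  let ?A = "Poly_Mapping.keys f \<union> Poly_Mapping.keys g"
  have "Poly_Mapping.keys (f + g) \<subseteq> ?A"
    by (rule Poly_Mapping.keys_add)
  then have "subst_poly \<sigma> (f + g) =
      (\<Sum>m\<in>?A. Const (Poly_Mapping.lookup (f + g) m) * subst_monom \<sigma> m)"
    by (intro subst_poly_superset) auto
  also have "\<dots> = subst_poly \<sigma> f + subst_poly \<sigma> g"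
    by (simp add: subst_poly_superset[of ?A] lookup_add Const_add distrib_right sum.distrib)
  finally show ?thesis .
qed

lemma subst_poly_0 [simp]: "subst_poly \<sigma> 0 = 0"
  by (simp add: subst_poly_def)

lemma subst_poly_single: "subst_poly \<sigma> (Poly_Mapping.single m c) = Const c * subst_monom \<sigma> m"
  by (cases "c = 0") (simp_all add: subst_poly_def)

lemma subst_poly_Const [simp]: "subst_poly \<sigma> (Const c) = Const c"
  by (simp add: Const_def [of c] subst_poly_single subst_monom_def)

lemma subst_poly_1 [simp]: "subst_poly \<sigma> 1 = 1"
  using subst_poly_Const[of \<sigma> 1] by simp

lemma subst_poly_Var [simp]: "subst_poly \<sigma> (Var i) = \<sigma> i"
  by (simp add: Var_def subst_poly_single subst_monom_def)

lemma inf_poly_expand: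
  "f = (\<Sum>m\<in>Poly_Mapping.keys f. Poly_Mapping.single m (Poly_Mapping.lookup f m))"
  by (rule poly_mapping_eqI)
     (auto simp: lookup_sum lookup_single when_def in_keys_iff)

lemma inf_poly_induct [case_names zero single add]:
  fixes P :: "'k::field inf_poly \<Rightarrow> bool"
  assumes "P 0" "\<And>m c. P (Poly_Mapping.single m c)" "\<And>f g. P f \<Longrightarrow> P g \<Longrightarrow> P (f + g)"
  shows "P f"
proof -
  have "P (\<Sum>m\<in>A. Poly_Mapping.single m (Poly_Mapping.lookup f m))" if "finite A" for A
    using that by (induction A) (auto intro: assms)
  then show ?thesis
    using inf_poly_expand[of f] by (metis finite_keys)
qed

lemma subst_poly_mult: "subst_poly \<sigma> (f * g) = subst_poly \<sigma> f * subst_poly \<sigma> g"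
proof (induction f rule: inf_poly_induct)
  case (single m c)
  show ?case
    by (induction g rule: inf_poly_induct)
       (simp_all add: mult_single subst_poly_single subst_monom_add Const_mult
          distrib_left subst_poly_add)
qed (simp_all add: distrib_right subst_poly_add)

lemma subst_monom_Var: "subst_monom Var m = Poly_Mapping.single m (1::'k::field)"
proof -
  have pw: "(Var i :: 'k inf_poly) ^ n = Poly_Mapping.single (Poly_Mapping.single i n) 1" for i n
    by (induction n) (simp_all add: Var_def mult_single flip: single_add)
  have pr: "(\<Prod>i\<in>A. Poly_Mapping.single (h i) (1::'k)) = Poly_Mapping.single (\<Sum>i\<in>A. h i) 1"
    if "finite A" for A and h :: "nat \<Rightarrow> nat \<Rightarrow>\<^sub>0 nat"
    using that by (induction A) (simp_all add: mult_single)
  have "(\<Sum>i\<in>Poly_Mapping.keys m. Poly_Mapping.single i (Poly_Mapping.lookup m i)) = m"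
    by (rule poly_mapping_eqI)
       (auto simp: lookup_sum lookup_single when_def in_keys_iff)
  then show ?thesis
    by (simp add: subst_monom_def pw pr)
qed

lemma algebra_hom_eq_subst_poly:
  fixes \<phi> :: "'k::field inf_poly \<Rightarrow> 'k inf_poly"
  assumes add: "\<And>f g. \<phi> (f + g) = \<phi> f + \<phi> g"
    and mult: "\<And>f g. \<phi> (f * g) = \<phi> f * \<phi> g"
    and const: "\<And>c. \<phi> (Const c) = Const c"
  shows "\<phi> f = subst_poly (\<lambda>i. \<phi> (Var i)) f"
proof (induction f rule: inf_poly_induct)
  case zero
  show ?case using const[of 0] by simp
next
  case (single m c)
  have one: "\<phi> 1 = 1" using const[of 1] by simp
  have pow: "\<phi> (f ^ n) = \<phi> f ^ n" for f n
    by (induction n) (simp_all add: mult one)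
  have prod: "\<phi> (\<Prod>i\<in>A. h i) = (\<Prod>i\<in>A. \<phi> (h i))" if "finite A"
    for A and h :: "nat \<Rightarrow> 'k inf_poly"
    using that by (induction A) (simp_all add: mult one)
  have "Poly_Mapping.single m c = Const c * subst_monom Var m"
    by (simp add: subst_monom_Var Const_def mult_single)
  then have "\<phi> (Poly_Mapping.single m c) = Const c * \<phi> (subst_monom Var m)"
    by (simp add: mult const)
  also have "\<phi> (subst_monom Var m) = subst_monom (\<lambda>i. \<phi> (Var i)) m"
    by (simp add: subst_monom_def prod pow)
  finally show ?case by (simp add: subst_poly_single)
qed (simp add: add subst_poly_add)

lemma linear_form_superset:
  assumes "finite A" "Poly_Mapping.keys v \<subseteq> A"
  shows "linear_form v = (\<Sum>i\<in>A. Const (Poly_Mapping.lookup v i) * Var i)"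
  unfolding linear_form_def
  by (rule sum.mono_neutral_left) (use assms in \<open>auto simp: in_keys_iff\<close>)

lemma linear_form_add: "linear_form (v + w) = linear_form v + linear_form w"
proof -
  let ?A = "Poly_Mapping.keys v \<union> Poly_Mapping.keys w"
  have "Poly_Mapping.keys (v + w) \<subseteq> ?A"
    by (rule Poly_Mapping.keys_add)
  then have "linear_form (v + w) = (\<Sum>i\<in>?A. Const (Poly_Mapping.lookup (v + w) i) * Var i)"
    by (intro linear_form_superset) auto
  also have "\<dots> = linear_form v + linear_form w"
    by (simp add: linear_form_superset[of ?A] lookup_add Const_add distrib_right sum.distrib)
  finally show ?thesis .
qed

lemma linear_form_0 [simp]: "linear_form 0 = 0"
  by (simp add: linear_form_def)

lemma linear_form_scale: "linear_form (vec_scale c v) = Const c * linear_form v"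
proof -
  have "linear_form (vec_scale c v) =
      (\<Sum>i\<in>Poly_Mapping.keys v. Const (Poly_Mapping.lookup (vec_scale c v) i) * Var i)"
    by (rule linear_form_superset) (auto simp: in_keys_iff lookup_vec_scale)
  then show ?thesis
    by (simp add: lookup_vec_scale Const_mult linear_form_def sum_distrib_left mult.assoc)
qed

lemma linear_form_basis_vec [simp]: "linear_form (basis_vec i) = Var i"
  by (simp add: linear_form_def basis_vec_def)

lemma fin_vec_expand:
  "v = (\<Sum>i\<in>Poly_Mapping.keys v. vec_scale (Poly_Mapping.lookup v i) (basis_vec i))"
  by (rule poly_mapping_eqI)
     (auto simp: lookup_sum lookup_vec_scale basis_vec_def lookup_single when_def in_keys_iff
        if_distrib[of "(*) _"] cong: if_cong)

lemma GL_act_add: "GL_act g (f + f') = GL_act g f + GL_act g f'"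
  and GL_act_mult: "GL_act g (f * f') = GL_act g f * GL_act g f'"
  and GL_act_Const: "GL_act g (Const c) = Const c"
  by (simp_all add: GL_act_def subst_poly_add subst_poly_mult)

lemma GL_act_linear_form:
  assumes "g \<in> GL"
  shows "GL_act g (linear_form v) = linear_form (g v)"
proof -
  interpret g: Vector_Spaces.linear vec_scale vec_scale g
    using assms by (simp add: GL_def)
  have *: "GL_act g (linear_form (\<Sum>i\<in>A. vec_scale (c i) (basis_vec i))) =
      linear_form (g (\<Sum>i\<in>A. vec_scale (c i) (basis_vec i)))" if "finite A" for A c
    using that
  proof (induction A)
    case empty
    then show ?case by (simp add: GL_act_def)
  next
    case (insert i A)
    then show ?case
      by (simp add: linear_form_add linear_form_scale GL_act_add GL_act_mult GL_act_Const
            g.add g.scale)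
         (simp add: GL_act_def)
  qed
  show ?thesis
    using *[OF finite_keys] fin_vec_expand[of v] by metis
qed

lemma GL_act_unique:
  fixes \<phi> :: "'k::field inf_poly \<Rightarrow> 'k inf_poly"
  assumes "\<And>f f'. \<phi> (f + f') = \<phi> f + \<phi> f'" "\<And>f f'. \<phi> (f * f') = \<phi> f * \<phi> f'"
    and "\<And>c. \<phi> (Const c) = Const c" "\<And>v. \<phi> (linear_form v) = linear_form (g v)"
  shows "\<phi> = GL_act g"
proof
  fix f
  have "\<phi> (Var i) = linear_form (g (basis_vec i))" for i
    using assms(4)[of "basis_vec i"] by simp
  then show "\<phi> f = GL_act g f"
    using algebra_hom_eq_subst_poly[of \<phi> f] assms by (simp add: GL_act_def)
qed

lemma GL_id: "id \<in> GL"
proof -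
  interpret vector_space "vec_scale :: 'a::field \<Rightarrow> _" by (rule vector_space_vec_scale)
  show "(id :: 'a fin_vec \<Rightarrow> _) \<in> GL"
    by (auto simp: GL_def linear_id)
qed

lemma GL_comp: "g \<in> GL \<Longrightarrow> h \<in> GL \<Longrightarrow> g \<circ> h \<in> GL"
proof -
  assume "g \<in> GL" "h \<in> GL"
  moreover have "finite {i. (g \<circ> h) (basis_vec i) \<noteq> basis_vec i}"
    if "finite {i. g (basis_vec i) \<noteq> basis_vec i}" "finite {i. h (basis_vec i) \<noteq> basis_vec i}"
    by (rule finite_subset[OF _ finite_UnI[OF that]]) auto
  ultimately show "g \<circ> h \<in> GL"
    by (auto simp: GL_def bij_comp intro: Vector_Spaces.linear_compose)
qed

lemma GL_inv:
  assumes "g \<in> GL"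
  shows "inv_into UNIV g \<in> GL"
proof -
  interpret g: Vector_Spaces.linear vec_scale vec_scale g
    using assms by (simp add: GL_def)
  have bij: "bij g" and fin: "finite {i. g (basis_vec i) \<noteq> basis_vec i}"
    using assms by (auto simp: GL_def)
  have gi: "g (inv_into UNIV g x) = x" and ig: "inv_into UNIV g (g x) = x" for x
    using bij by (simp_all add: bij_is_inj bij_is_surj surj_f_inv_f)
  have "inv_into UNIV g (x + y) = inv_into UNIV g x + inv_into UNIV g y" "inv_into UNIV g (vec_scale c x) = vec_scale c (inv_into UNIV g x)" for x y c
    by (metis gi ig g.add, metis gi ig g.scale)
  then have "Vector_Spaces.linear vec_scale vec_scale (inv_into UNIV g)"
    by unfold_locales auto
  moreover have "{i. inv_into UNIV g (basis_vec i) \<noteq> basis_vec i} \<subseteq> {i. g (basis_vec i) \<noteq> basis_vec i}"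
    using ig by auto (metis ig)
  ultimately show ?thesis
    using bij fin by (auto simp: GL_def bij_imp_bij_inv intro: finite_subset)
qed

lemma GL_act_id: "GL_act id = id"
  by (rule sym, rule GL_act_unique) auto

lemma GL_act_comp:
  assumes "g \<in> GL" "h \<in> GL"
  shows "GL_act (g \<circ> h) = GL_act g \<circ> GL_act h"
  by (rule sym, rule GL_act_unique)
     (simp_all add: GL_act_add GL_act_mult GL_act_Const GL_act_linear_form assms)

lemma bij_GL_act:
  assumes "g \<in> GL"
  shows "bij (GL_act g)"
proof (rule o_bij)
  have "bij g" using assms by (simp add: GL_def)
  then have "inv_into UNIV g \<circ> g = id" "g \<circ> inv_into UNIV g = id"
    by (auto simp: bij_is_inj bij_is_surj surj_f_inv_f)
  then show "GL_act (inv_into UNIV g) \<circ> GL_act g = id" "GL_act g \<circ> GL_act (inv_into UNIV g) = id"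
    using assms GL_inv[OF assms]
    by (simp_all add: GL_act_id flip: GL_act_comp)
qed

end

theory Submission
  imports Defs
begin

text \<open>
  Over an infinite field the diagonal matrices already force a stable ideal to be spanned by
  monomials (\<open>GL_stable_monomial\<close>).  Because there are infinitely many variables, such an ideal is
  stable even under all linear substitutions of the variables, invertible or not
  (\<open>GL_stable_lin_subst\<close>): add a fresh variable to each image, which makes the substitution
  invertible, and then discard the monomials that contain fresh variables.

  Hence two monomials in disjoint sets of variables behave like independent elements: if \<open>uv\<close> lies
  in a stable ideal, so does the product of any linear substitution of \<open>u\<close> with any one of \<open>v\<close>.  A
  \<open>GL\<close>-prime ideal containing \<open>uv\<close> therefore contains \<open>u\<close> or \<open>v\<close>
  (\<open>GL_prime_disjoint_monomials\<close>), and a monomial in a prime ideal has a factor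
  \<open>x\<^sub>i\<^sup>a\<close> in the ideal, with \<open>a\<close> its full exponent at \<open>i\<close>.  As the variables are interchangeable,
  a nonzero prime ideal is generated by the \<open>d\<close>-th powers of the variables for some \<open>d > 0\<close>
  (\<open>GL_prime_eq_high_exponent_ideal\<close>).

  Stability restricts \<open>d\<close>.  Write \<open>d = m q\<close> with \<open>q\<close> a power of \<open>p\<close> and \<open>p\<close> not dividing \<open>m\<close>.  The
  ideal contains \<open>(x + y)\<^sup>d = (x\<^sup>q + y\<^sup>q)\<^sup>m\<close>, in which \<open>x\<^sup>q y\<^bsup>q(m - 1)\<^esup>\<close> has the nonzero
  coefficient \<open>m\<close>; for \<open>m > 1\<close> both exponents are below \<open>d\<close>, so \<open>m = 1\<close>
  (\<open>exponent_is_prime_power\<close>).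

  Conversely, additivity of the \<open>q\<close>-th power makes the ideal of \<open>q\<close>-th powers stable.  Given two
  stable ideals not contained in it, take a monomial outside it from each and move the second one
  to fresh variables: the product of the two is in the product ideal, and its exponents are still
  below \<open>q\<close>.  The same argument settles the zero ideal (\<open>GL_primeI\<close>).
\<close>

section \<open>Linear substitutions\<close>

lemma subst_poly_cong:
  assumes "\<And>m i. m \<in> Poly_Mapping.keys f \<Longrightarrow> i \<in> Poly_Mapping.keys m \<Longrightarrow> \<sigma> i = \<tau> i"
  shows "subst_poly \<sigma> f = subst_poly \<tau> f"
  unfolding subst_poly_def subst_monom_def using assms by (auto intro!: sum.cong prod.cong)

lemma subst_poly_subst_poly:
  "subst_poly \<sigma> (subst_poly \<tau> f) = subst_poly (\<lambda>i. subst_poly \<sigma> (\<tau> i)) f"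
  using algebra_hom_eq_subst_poly[of "\<lambda>f. subst_poly \<sigma> (subst_poly \<tau> f)" f]
  by (simp add: subst_poly_add subst_poly_mult)

lemma subst_poly_Var_id: "subst_poly Var f = f"
  using algebra_hom_eq_subst_poly[of "\<lambda>f. f" f] by simp

text \<open>
  A family of vectors \<open>w\<close> gives an endomorphism of the vector space, \<open>lin_ext w\<close>, and one of the
  polynomial ring, \<open>lin_subst w\<close>.  The latter extends \<open>GL_act\<close> to arbitrary, possibly
  noninvertible families.
\<close>

definition lin_ext :: "(nat \<Rightarrow> 'k::field fin_vec) \<Rightarrow> 'k fin_vec \<Rightarrow> 'k fin_vec" where
  "lin_ext w v = (\<Sum>i\<in>Poly_Mapping.keys v. vec_scale (Poly_Mapping.lookup v i) (w i))"

definition lin_subst :: "(nat \<Rightarrow> 'k::field fin_vec) \<Rightarrow> 'k inf_poly \<Rightarrow> 'k inf_poly" where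
  "lin_subst w = subst_poly (\<lambda>i. linear_form (w i))"

lemma lookup_lin_ext:
  assumes "finite A" "Poly_Mapping.keys v \<subseteq> A"
  shows "Poly_Mapping.lookup (lin_ext w v) j =
    (\<Sum>i\<in>A. Poly_Mapping.lookup v i * Poly_Mapping.lookup (w i) j)"
  unfolding lin_ext_def lookup_sum lookup_vec_scale
  by (rule sum.mono_neutral_left) (use assms in \<open>auto simp: in_keys_iff\<close>)

lemma lin_ext_basis_vec: "lin_ext w (basis_vec i) = w i"
  by (rule poly_mapping_eqI) (simp add: lin_ext_def basis_vec_def lookup_vec_scale)

lemma linear_lin_ext: "Vector_Spaces.linear vec_scale vec_scale (lin_ext w)"
proof -
  interpret vector_space "vec_scale :: 'a::field \<Rightarrow> _" by (rule vector_space_vec_scale)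
  show ?thesis
  proof unfold_locales
    show "lin_ext w (u + v) = lin_ext w u + lin_ext w v" for u v
    proof (rule poly_mapping_eqI)
      fix j
      let ?A = "Poly_Mapping.keys u \<union> Poly_Mapping.keys v"
      have "Poly_Mapping.keys (u + v) \<subseteq> ?A" by (rule Poly_Mapping.keys_add)
      then show "Poly_Mapping.lookup (lin_ext w (u + v)) j =
          Poly_Mapping.lookup (lin_ext w u + lin_ext w v) j"
        by (simp add: lookup_add lookup_lin_ext[of ?A] distrib_right sum.distrib)
    qed
    show "lin_ext w (vec_scale c v) = vec_scale c (lin_ext w v)" for c v
    proof (rule poly_mapping_eqI)
      fix j
      have "Poly_Mapping.keys (vec_scale c v) \<subseteq> Poly_Mapping.keys v"
        by (auto simp: in_keys_iff lookup_vec_scale)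
      then show "Poly_Mapping.lookup (lin_ext w (vec_scale c v)) j =
          Poly_Mapping.lookup (vec_scale c (lin_ext w v)) j"
        by (simp add: lookup_vec_scale lookup_lin_ext[of "Poly_Mapping.keys v"]
            sum_distrib_left mult.assoc)
    qed
  qed
qed

lemma lin_ext_lin_ext: "lin_ext w (lin_ext w' v) = lin_ext (\<lambda>i. lin_ext w (w' i)) v"
proof -
  interpret Vector_Spaces.linear vec_scale vec_scale "lin_ext w" by (rule linear_lin_ext)
  have "lin_ext w (lin_ext w' v) =
      (\<Sum>i\<in>Poly_Mapping.keys v. vec_scale (Poly_Mapping.lookup v i) (lin_ext w (w' i)))"
    by (simp add: lin_ext_def[of w' v] sum scale)
  then show ?thesis by (simp add: lin_ext_def[of _ v])
qed

lemma lin_ext_basis: "lin_ext basis_vec v = v"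
  using fin_vec_expand[of v] by (simp add: lin_ext_def)

lemma lin_ext_in_GL:
  assumes "\<And>i. lin_ext w (w' i) = basis_vec i" "\<And>i. lin_ext w' (w i) = basis_vec i"
    and "finite {i. w i \<noteq> basis_vec i}"
  shows "lin_ext w \<in> GL"
proof -
  have "lin_ext w \<circ> lin_ext w' = id" "lin_ext w' \<circ> lin_ext w = id"
    using assms(1,2) by (auto simp: fun_eq_iff lin_ext_lin_ext lin_ext_basis)
  then have "bij (lin_ext w)" by (metis o_bij)
  then show ?thesis
    using assms(3) by (simp add: GL_def linear_lin_ext lin_ext_basis_vec)
qed

lemma GL_act_eq_lin_subst: "GL_act g = lin_subst (\<lambda>i. g (basis_vec i))"
  by (simp add: GL_act_def lin_subst_def)

lemma GL_act_lin_ext: "GL_act (lin_ext w) = lin_subst w"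
  by (simp add: GL_act_eq_lin_subst lin_ext_basis_vec)

lemma lin_subst_add: "lin_subst w (f + g) = lin_subst w f + lin_subst w g"
  and lin_subst_mult: "lin_subst w (f * g) = lin_subst w f * lin_subst w g"
  and lin_subst_Var: "lin_subst w (Var i) = linear_form (w i)"
  and lin_subst_Const: "lin_subst w (Const c) = Const c"
  and lin_subst_0: "lin_subst w 0 = 0"
  by (simp_all add: lin_subst_def subst_poly_add subst_poly_mult)

lemma lin_subst_basis: "lin_subst basis_vec f = f"
  by (simp add: lin_subst_def subst_poly_Var_id)

lemma GL_act_lin_subst:
  assumes "g \<in> GL"
  shows "GL_act g (lin_subst w f) = lin_subst (\<lambda>i. g (w i)) f"
  using GL_act_linear_form[OF assms]
  by (simp add: lin_subst_def GL_act_def subst_poly_subst_poly)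

section \<open>Stable ideals are spanned by monomials\<close>

text \<open>
  Closure under negation is multiplication by \<open>- 1\<close>, so the locale-based notion of an ideal reduces
  to closure conditions in the ring operations of the type.
\<close>

lemma ideal_poly_ring_iff:
  "ideal I (poly_ring :: 'k::field inf_poly ring) \<longleftrightarrow>
     0 \<in> I \<and> (\<forall>f\<in>I. \<forall>g\<in>I. f + g \<in> I) \<and> (\<forall>f\<in>I. \<forall>h. h * f \<in> I)"
proof
  assume "ideal I poly_ring"
  then interpret ideal I "poly_ring :: 'k inf_poly ring" .
  show "0 \<in> I \<and> (\<forall>f\<in>I. \<forall>g\<in>I. f + g \<in> I) \<and> (\<forall>f\<in>I. \<forall>h. h * f \<in> I)"
    using additive_subgroup.zero_closed[OF is_additive_subgroup]
      additive_subgroup.a_closed[OF is_additive_subgroup] I_l_closed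
    by (auto simp: ring_of_type_algebra_def)
next
  interpret ring "poly_ring :: 'k inf_poly ring" by (rule ring_from_type_algebra)
  assume *: "0 \<in> I \<and> (\<forall>f\<in>I. \<forall>g\<in>I. f + g \<in> I) \<and> (\<forall>f\<in>I. \<forall>h. h * f \<in> I)"
  show "ideal I poly_ring"
  proof (rule idealI)
    show "ring (poly_ring :: 'k inf_poly ring)" by (rule ring_from_type_algebra)
    have "subgroup I (add_monoid (poly_ring :: 'k inf_poly ring))"
    proof (rule add.subgroupI)
      show "I \<noteq> {}" using * by auto
      show "\<ominus>\<^bsub>poly_ring\<^esub> a \<in> I" if "a \<in> I" for a
      proof -
        have "(- 1) * a \<in> I" using * that by blast
        moreover have "\<ominus>\<^bsub>poly_ring\<^esub> a = - a"
          by (rule minus_equality) (auto simp: ring_of_type_algebra_def)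
        ultimately show ?thesis by simp
      qed
    qed (use * in \<open>auto simp: ring_of_type_algebra_def\<close>)
    then show "subgroup I (add_monoid (poly_ring :: 'k inf_poly ring))" .
  qed (use * in \<open>auto simp: ring_of_type_algebra_def mult.commute\<close>)
qed

lemma ideal_sum:
  assumes "ideal I (poly_ring :: 'k::field inf_poly ring)" "\<And>x. x \<in> A \<Longrightarrow> h x \<in> I"
  shows "(\<Sum>x\<in>A. h x) \<in> I"
  using assms by (induction A rule: infinite_finite_induct) (auto simp: ideal_poly_ring_iff)

abbreviation monomial :: "(nat \<Rightarrow>\<^sub>0 nat) \<Rightarrow> 'k::field inf_poly" where
  "monomial m \<equiv> Poly_Mapping.single m 1"

lemma single_eq_Const_mult: "Poly_Mapping.single m c = Const c * monomial m"
  by (simp add: Const_def mult_single)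

text \<open>
  The characters \<open>t \<mapsto> t\<^sup>a\<close> of the multiplicative group of an infinite field are pairwise distinct; this is how the diagonal matrices separate monomials.
\<close>

lemma exists_distinct_powers:
  assumes "infinite (UNIV :: 'k::field set)" "a \<noteq> b"
  obtains t :: "'k::field" where "t \<noteq> 0" "t ^ a \<noteq> t ^ b"
proof -
  let ?q = "Polynomial.monom (1::'k) a - Polynomial.monom 1 b"
  have "coeff ?q a = 1" using assms(2) by simp
  then have "?q \<noteq> 0" by (metis Polynomial.coeff_0 zero_neq_one)
  then have "finite ({t. poly ?q t = 0} \<union> {0})" by (intro finite_UnI poly_roots_finite) auto
  then obtain t where "t \<notin> {t. poly ?q t = 0} \<union> {0}"
    using assms(1) by (metis ex_new_if_finite)
  then show ?thesis using that[of t] by (simp add: poly_monom)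
qed

lemma lookup_Const_mult: "Poly_Mapping.lookup (Const c * g) k = c * Poly_Mapping.lookup g k"
proof (induction g rule: inf_poly_induct)
  case (single m' c')
  then show ?case by (simp add: Const_def mult_single lookup_single when_def)
qed (simp_all add: distrib_left lookup_add)

definition scale_var :: "nat \<Rightarrow> 'k::field \<Rightarrow> nat \<Rightarrow> 'k fin_vec" where
  "scale_var i t j = vec_scale (if j = i then t else 1) (basis_vec j)"

lemma scale_var_in_GL:
  assumes "t \<noteq> (0::'k::field)"
  shows "lin_ext (scale_var i t) \<in> GL"
proof (rule lin_ext_in_GL)
  interpret vector_space "vec_scale :: 'k \<Rightarrow> _" by (rule vector_space_vec_scale)
  have *: "lin_ext (scale_var i t) (scale_var i s j) = basis_vec j" if "t * s = 1" for j and t s :: 'k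
  proof -
    interpret Vector_Spaces.linear vec_scale vec_scale "lin_ext (scale_var i t)"
      by (rule linear_lin_ext)
    show ?thesis
      using that by (simp add: scale_var_def scale lin_ext_basis_vec mult.commute)
  qed
  show "lin_ext (scale_var i t) (scale_var i (1 / t) j) = basis_vec j"
    "lin_ext (scale_var i (1 / t)) (scale_var i t j) = basis_vec j" for j
    using assms by (auto intro!: *)
  show "finite {j. scale_var i t j \<noteq> basis_vec j}"
    by (rule finite_subset[of _ "{i}"]) (auto simp: scale_var_def)
qed

lemma subst_monom_scale_var:
  "subst_monom (\<lambda>j. linear_form (scale_var i t j)) m =
     Const (t ^ Poly_Mapping.lookup m i) * monomial m"
proof -
  have pw: "Const (c ^ n) = Const c ^ n" for c :: 'a and n
    by (induction n) (simp_all add: Const_mult)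
  let ?A = "insert i (Poly_Mapping.keys m)"
  have "subst_monom (\<lambda>j. linear_form (scale_var i t j)) m =
    (\<Prod>j\<in>?A. Const (if j = i then t else 1) ^ Poly_Mapping.lookup m j) *
    (\<Prod>j\<in>?A. Var j ^ Poly_Mapping.lookup m j)"
    by (subst subst_monom_superset[of ?A])
       (auto simp: scale_var_def linear_form_scale power_mult_distrib prod.distrib)
  also have "(\<Prod>j\<in>?A. Var j ^ Poly_Mapping.lookup m j) = (monomial m :: 'a inf_poly)"
    by (subst subst_monom_Var[symmetric], subst subst_monom_superset[of ?A]) auto
  also have "(\<Prod>j\<in>?A. Const (if j = i then t else 1) ^ Poly_Mapping.lookup m j) =
      (\<Prod>j\<in>?A. if j = i then Const t ^ Poly_Mapping.lookup m i else 1)"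
    by (rule prod.cong) auto
  also have "\<dots> = Const (t ^ Poly_Mapping.lookup m i)"
    by (simp add: pw del: prod.insert_if)
  finally show ?thesis .
qed

lemma lookup_scale_var:
  "Poly_Mapping.lookup (lin_subst (scale_var i t) f) m =
     t ^ Poly_Mapping.lookup m i * Poly_Mapping.lookup f m"
proof (induction f rule: inf_poly_induct)
  case (single n c)
  show ?case
    by (simp add: lin_subst_def subst_poly_single subst_monom_scale_var)
       (simp add: Const_def mult_single lookup_single when_def)
qed (simp_all add: lin_subst_0 lin_subst_add lookup_add distrib_left)

text \<open>
  An ideal stable under the diagonal matrices is graded by exponent vectors, and each graded piece
  is a line spanned by a monomial.  Instead of inverting a Vandermonde matrix, the proof removes
  one monomial at a time.
\<close>

lemma GL_stable_monomial:
  fixes P :: "'k::field inf_poly set"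
  assumes inf: "infinite (UNIV :: 'k set)" and P: "GL_stable_ideal P"
    and "f \<in> P" "m \<in> Poly_Mapping.keys f"
  shows "monomial m \<in> P"
  using \<open>f \<in> P\<close> \<open>m \<in> Poly_Mapping.keys f\<close>
proof (induction "card (Poly_Mapping.keys f)" arbitrary: f rule: less_induct)
  case less
  note id = P[unfolded GL_stable_ideal_def ideal_poly_ring_iff]
  show ?case
  proof (cases "Poly_Mapping.keys f = {m}")
    case True
    define c where "c = Poly_Mapping.lookup f m"
    have "c \<noteq> 0" using less.prems by (simp add: c_def in_keys_iff)
    have "f = Poly_Mapping.single m c"
      using inf_poly_expand[of f] by (simp add: True c_def)
    then have "Const (1 / c) * f = monomial m"
      using \<open>c \<noteq> 0\<close> by (simp add: Const_def mult_single)
    then show ?thesis using id less.prems by metis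
  next
    case False
    then obtain n where n: "n \<in> Poly_Mapping.keys f" "n \<noteq> m" using less.prems by auto
    then obtain i where "Poly_Mapping.lookup m i \<noteq> Poly_Mapping.lookup n i"
      by (metis poly_mapping_eqI)
    then obtain t :: 'k where t: "t \<noteq> 0" "t ^ Poly_Mapping.lookup m i \<noteq> t ^ Poly_Mapping.lookup n i"
      using exists_distinct_powers[OF inf] by metis
    \<comment> \<open>Scaling \<open>x\<^sub>i\<close> by \<open>t\<close> multiplies the terms at \<open>m\<close> and \<open>n\<close> by different factors, so this
      combination cancels the term at \<open>n\<close> and keeps the one at \<open>m\<close>.\<close>
    define f' where "f' = lin_subst (scale_var i t) f + Const (- (t ^ Poly_Mapping.lookup n i)) * f"
    have "lin_subst (scale_var i t) f \<in> P"
      using id less.prems scale_var_in_GL[OF t(1), of i] by (metis GL_act_lin_ext)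
    then have "f' \<in> P" using id less.prems by (simp add: f'_def)
    have f': "Poly_Mapping.lookup f' k =
        (t ^ Poly_Mapping.lookup k i - t ^ Poly_Mapping.lookup n i) * Poly_Mapping.lookup f k" for k
      by (simp add: f'_def lookup_add lookup_scale_var lookup_Const_mult left_diff_distrib)
    then have "Poly_Mapping.keys f' \<subseteq> Poly_Mapping.keys f" "n \<notin> Poly_Mapping.keys f'"
      "m \<in> Poly_Mapping.keys f'"
      using t(2) less.prems by (auto simp: in_keys_iff)
    moreover from this have "card (Poly_Mapping.keys f') < card (Poly_Mapping.keys f)"
      using n by (intro psubset_card_mono) auto
    ultimately show ?thesis using less.hyps \<open>f' \<in> P\<close> by metis
  qed
qed

lemma ideal_monomials:
  assumes "ideal I (poly_ring :: 'k::field inf_poly ring)"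
    and "\<And>m. m \<in> Poly_Mapping.keys f \<Longrightarrow> monomial m \<in> I"
  shows "f \<in> I"
proof -
  have "(\<Sum>m\<in>Poly_Mapping.keys f. Poly_Mapping.single m (Poly_Mapping.lookup f m)) \<in> I"
    using assms(2)
    by (intro ideal_sum assms(1), subst single_eq_Const_mult)
       (use assms(1) in \<open>auto simp: ideal_poly_ring_iff\<close>)
  then show ?thesis using inf_poly_expand[of f] by simp
qed


section \<open>Stability under all linear substitutions\<close>

lemma lin_ext_cong:
  assumes "\<And>i. i \<in> Poly_Mapping.keys v \<Longrightarrow> w i = w' i"
  shows "lin_ext w v = lin_ext w' v"
  using assms by (simp add: lin_ext_def)

lemma lin_subst_sum: "lin_subst w (\<Sum>x\<in>A. h x) = (\<Sum>x\<in>A. lin_subst w (h x))"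
  by (induction A rule: infinite_finite_induct) (simp_all add: lin_subst_0 lin_subst_add)

lemma lin_subst_power: "lin_subst w (f ^ n) = lin_subst w f ^ n"
  by (induction n) (simp_all add: lin_subst_mult, simp add: lin_subst_def)

lemma linear_form_sum: "linear_form (\<Sum>x\<in>A. h x) = (\<Sum>x\<in>A. linear_form (h x))"
  by (induction A rule: infinite_finite_induct) (simp_all add: linear_form_add)

lemma lin_subst_linear_form: "lin_subst w (linear_form v) = linear_form (lin_ext w v)"
  by (simp add: linear_form_def[of v] lin_ext_def linear_form_sum linear_form_scale
      lin_subst_sum lin_subst_mult lin_subst_Const lin_subst_Var)

lemma lin_subst_lin_subst: "lin_subst w (lin_subst w' f) = lin_subst (\<lambda>i. lin_ext w (w' i)) f"
proof -
  have "lin_subst w (lin_subst w' f) = subst_poly (\<lambda>i. lin_subst w (linear_form (w' i))) f"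
    unfolding lin_subst_def by (rule subst_poly_subst_poly)
  then show ?thesis by (simp only: lin_subst_linear_form) (simp only: lin_subst_def)
qed

text \<open>
  For \<open>i < N\<close>, \<open>unfold_map N w\<close> sends \<open>e\<^sub>i\<close> to \<open>w i\<close> plus the fresh basis vector \<open>e\<^bsub>N+i\<^esub>\<close>, and
  the fresh vector back to \<open>e\<^sub>i\<close>.  It is the swap of \<open>e\<^sub>i\<close> and \<open>e\<^bsub>N+i\<^esub>\<close> followed by the unipotent
  map that adds \<open>w i\<close> to \<open>e\<^bsub>N+i\<^esub>\<close>, hence invertible for any \<open>w\<close> with values in the span of the
  first \<open>N\<close> basis vectors; \<open>unfold_inv N w\<close> describes the inverse.
\<close>

definition unfold_map :: "nat \<Rightarrow> (nat \<Rightarrow> 'k::field fin_vec) \<Rightarrow> nat \<Rightarrow> 'k fin_vec" where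
  "unfold_map N w i =
     (if i < N then basis_vec (N + i) + w i
      else if i < 2 * N then basis_vec (i - N) else basis_vec i)"

definition unfold_inv :: "nat \<Rightarrow> (nat \<Rightarrow> 'k::field fin_vec) \<Rightarrow> nat \<Rightarrow> 'k fin_vec" where
  "unfold_inv N w i =
     (if i < N then basis_vec (N + i)
      else if i < 2 * N then basis_vec (i - N) - lin_ext (\<lambda>j. basis_vec (N + j)) (w (i - N))
      else basis_vec i)"

lemma unfold_map_in_GL:
  assumes w: "\<And>i. Poly_Mapping.keys (w i) \<subseteq> {..<N}"
  shows "lin_ext (unfold_map N w) \<in> GL"
proof (rule lin_ext_in_GL)
  interpret f: Vector_Spaces.linear vec_scale vec_scale "lin_ext (unfold_map N w)"
    by (rule linear_lin_ext)
  interpret g: Vector_Spaces.linear vec_scale vec_scale "lin_ext (unfold_inv N w)"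
    by (rule linear_lin_ext)
  show "lin_ext (unfold_map N w) (unfold_inv N w i) = basis_vec i" for i
  proof -
    have key: "lin_ext (\<lambda>j. unfold_map N w (N + j)) (w k) = w k" for k
    proof -
      have "lin_ext (\<lambda>j. unfold_map N w (N + j)) (w k) = lin_ext basis_vec (w k)"
        by (rule lin_ext_cong) (use w[of k] in \<open>auto simp: unfold_map_def\<close>)
      then show ?thesis by (simp add: lin_ext_basis)
    qed
    consider "i < N" | k where "i = N + k" "k < N" | "2 * N \<le> i"
      by (metis add_diff_inverse_nat mult_2 nat_add_left_cancel_less not_le)
    then show ?thesis
    proof cases
      case 1
      then show ?thesis by (simp add: unfold_inv_def lin_ext_basis_vec unfold_map_def)
    next
      case 2
      then have "lin_ext (unfold_map N w) (unfold_inv N w i) = unfold_map N w k - w k"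
        by (simp add: unfold_inv_def f.diff lin_ext_basis_vec lin_ext_lin_ext key)
      then show ?thesis using 2 by (simp add: unfold_map_def)
    next
      case 3
      then show ?thesis by (simp add: unfold_inv_def lin_ext_basis_vec unfold_map_def)
    qed
  qed
  show "lin_ext (unfold_inv N w) (unfold_map N w i) = basis_vec i" for i
  proof -
    have "lin_ext (unfold_inv N w) (w k) = lin_ext (\<lambda>j. basis_vec (N + j)) (w k)" for k
      by (rule lin_ext_cong) (use w[of k] in \<open>auto simp: unfold_inv_def\<close>)
    moreover have "i - N < N" if "i < 2 * N" "\<not> i < N" using that by linarith
    ultimately show ?thesis
      by (simp add: unfold_map_def g.add lin_ext_basis_vec)
         (simp add: unfold_inv_def)
  qed
  show "finite {i. unfold_map N w i \<noteq> basis_vec i}"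
    by (rule finite_subset[of _ "{..<2 * N}"]) (auto simp: unfold_map_def)
qed

definition truncate :: "nat \<Rightarrow> nat \<Rightarrow> 'k::field fin_vec" where
  "truncate N i = (if i < N then basis_vec i else 0)"

text \<open>
  Setting variables to zero only drops terms, which a monomial ideal permits.
\<close>

lemma truncate_GL_stable:
  fixes P :: "'k::field inf_poly set"
  assumes inf: "infinite (UNIV :: 'k set)" and P: "GL_stable_ideal P" and f: "f \<in> P"
  shows "lin_subst (truncate N) f \<in> P"
proof -
  have id: "ideal P poly_ring" using P by (simp add: GL_stable_ideal_def)
  have sm: "subst_monom (\<lambda>i. linear_form (truncate N i)) m \<in> P"
    if "m \<in> Poly_Mapping.keys f" for m
  proof (cases "Poly_Mapping.keys m \<subseteq> {..<N}")
    case True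
    then have "subst_monom (\<lambda>i. linear_form (truncate N i)) m = (subst_monom Var m :: 'k inf_poly)"
      unfolding subst_monom_def by (intro prod.cong) (auto simp: truncate_def)
    then show ?thesis
      using GL_stable_monomial[OF inf P f that] by (simp add: subst_monom_Var)
  next
    case False
    then obtain i where i: "i \<in> Poly_Mapping.keys m" "\<not> i < N" by auto
    have "subst_monom (\<lambda>i. linear_form (truncate N i)) m = (0 :: 'k inf_poly)"
      unfolding subst_monom_def
      by (rule prod_zero) (use i in \<open>auto simp: truncate_def in_keys_iff power_0_left\<close>)
    then show ?thesis using id by (simp add: ideal_poly_ring_iff)
  qed
  show ?thesis
    unfolding lin_subst_def subst_poly_def
    by (rule ideal_sum[OF id]) (use sm id in \<open>auto simp: ideal_poly_ring_iff\<close>)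
qed

text \<open>
  On the variables of \<open>f\<close>, the family \<open>w\<close> agrees with \<open>unfold_map N w\<close> once the fresh variables
  are set to zero, and the latter comes from an element of \<open>GL\<close> if \<open>N\<close> bounds the
  variables of \<open>f\<close> and of its image.
\<close>

lemma GL_stable_lin_subst:
  fixes P :: "'k::field inf_poly set"
  assumes inf: "infinite (UNIV :: 'k set)" and P: "GL_stable_ideal P" and f: "f \<in> P"
  shows "lin_subst w f \<in> P"
proof -
  define V where "V = (\<Union>m\<in>Poly_Mapping.keys f. Poly_Mapping.keys m)"
  \<comment> \<open>Only the finitely many \<open>w i\<close> with \<open>x\<^sub>i\<close> in \<open>f\<close> matter; without this cut-off no \<open>N\<close> need
    bound all of \<open>w\<close>.\<close>
  define w' where "w' = (\<lambda>i. if i \<in> V then w i else 0)"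
  have "finite (V \<union> (\<Union>i\<in>V. Poly_Mapping.keys (w i)))" by (auto simp: V_def)
  then obtain N where N: "V \<union> (\<Union>i\<in>V. Poly_Mapping.keys (w i)) \<subseteq> {..<N}"
    unfolding finite_nat_iff_bounded by blast
  then have w': "Poly_Mapping.keys (w' i) \<subseteq> {..<N}" for i by (auto simp: w'_def)
  have "lin_subst (unfold_map N w') f \<in> P"
    using P f unfold_map_in_GL[of w' N, OF w']
    by (auto simp: GL_stable_ideal_def simp flip: GL_act_lin_ext)
  then have "lin_subst (truncate N) (lin_subst (unfold_map N w') f) \<in> P"
    by (rule truncate_GL_stable[OF inf P])
  also have "lin_subst (truncate N) (lin_subst (unfold_map N w') f) =
      lin_subst (\<lambda>i. lin_ext (truncate N) (unfold_map N w' i)) f"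
    by (rule lin_subst_lin_subst)
  also have "\<dots> = lin_subst w f"
    unfolding lin_subst_def
  proof (rule subst_poly_cong)
    fix m i assume "m \<in> Poly_Mapping.keys f" "i \<in> Poly_Mapping.keys m"
    then have i: "i \<in> V" "i < N" using N by (auto simp: V_def)
    interpret Vector_Spaces.linear vec_scale vec_scale "lin_ext (truncate N :: nat \<Rightarrow> 'k fin_vec)"
      by (rule linear_lin_ext)
    have "lin_ext (truncate N) (w' i) = lin_ext basis_vec (w' i)"
      by (rule lin_ext_cong) (use w' in \<open>auto simp: truncate_def\<close>)
    then have "lin_ext (truncate N) (unfold_map N w' i) = w i"
      using i by (simp add: unfold_map_def add lin_ext_basis_vec lin_ext_basis)
        (simp add: truncate_def w'_def)
    then show "linear_form (lin_ext (truncate N) (unfold_map N w' i)) = linear_form (w i)" by simp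
  qed
  finally show ?thesis .
qed

section \<open>Monomials in a prime ideal\<close>

lemma lin_subst_monomial:
  "lin_subst w (monomial m) = (\<Prod>i\<in>Poly_Mapping.keys m. linear_form (w i) ^ Poly_Mapping.lookup m i)"
  by (simp add: lin_subst_def subst_poly_single subst_monom_def)

lemma monomial_eq_prod:
  "monomial m = (\<Prod>i\<in>Poly_Mapping.keys m. Var i ^ Poly_Mapping.lookup m i)"
  unfolding subst_monom_Var[symmetric] subst_monom_def ..

lemma monomial_nonzero: "monomial m \<noteq> 0"
  by (metis lookup_single_eq lookup_zero zero_neq_one)

lemma monomial_add: "monomial (m + n) = monomial m * monomial n"
  by (simp add: mult_single)

lemma Var_power: "Var i ^ n = monomial (Poly_Mapping.single i n)"
  by (cases "n = 0") (simp_all add: monomial_eq_prod[of "Poly_Mapping.single i n"])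

text \<open>
  Let \<open>A\<close> consist of the polynomials whose product with every linear substitution of \<open>v\<close> is in
  \<open>P\<close>, and let \<open>B\<close> be the ideal quotient \<open>(P : A)\<close>.  Both are stable, their product is in \<open>P\<close>, and
  \<open>v\<close> is in \<open>B\<close>.  Since \<open>u\<close> and \<open>v\<close> share no variable, one substitution can fix \<open>u\<close> and act on
  \<open>v\<close> at will; so \<open>u\<close> is in \<open>A\<close>.
\<close>

lemma GL_prime_disjoint_monomials:
  fixes P :: "'k::field inf_poly set"
  assumes inf: "infinite (UNIV :: 'k set)" and P: "GL_prime P"
    and disj: "Poly_Mapping.keys u \<inter> Poly_Mapping.keys v = {}"
    and uv: "monomial (u + v) \<in> P"
  shows "monomial u \<in> P \<or> monomial v \<in> P"
proof -
  have stP: "GL_stable_ideal P" using P by (simp add: GL_prime_def)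
  then have idP: "0 \<in> P" "\<And>f g. f \<in> P \<Longrightarrow> g \<in> P \<Longrightarrow> f + g \<in> P" "\<And>f h. f \<in> P \<Longrightarrow> h * f \<in> P"
    and gP: "\<And>g f. g \<in> GL \<Longrightarrow> f \<in> P \<Longrightarrow> GL_act g f \<in> P"
    by (auto simp: GL_stable_ideal_def ideal_poly_ring_iff)
  define A where "A = {a. \<forall>w. a * lin_subst w (monomial v) \<in> P}"
  define B where "B = {b. \<forall>a\<in>A. a * b \<in> P}"
  \<comment> \<open>Both stability proofs apply \<open>g\<close> after moving its inverse to the other factor.\<close>
  have inv: "GL_act g (GL_act (inv_into UNIV g) f) = f" if "g \<in> GL" for g and f :: "'k inf_poly"
  proof -
    have "g \<circ> inv_into UNIV g = id"
      using that by (simp add: GL_def bij_is_surj surj_iff[symmetric])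
    then have "GL_act g \<circ> GL_act (inv_into UNIV g) = id"
      using that GL_inv[OF that] by (simp add: GL_act_id flip: GL_act_comp)
    then show ?thesis by (metis comp_apply id_apply)
  qed
  have stA: "GL_stable_ideal A"
    unfolding GL_stable_ideal_def ideal_poly_ring_iff
  proof (intro conjI ballI allI)
    fix g :: "'k fin_vec \<Rightarrow> 'k fin_vec" and a assume g: "g \<in> GL" and a: "a \<in> A"
    have "GL_act g a * lin_subst w (monomial v) \<in> P" for w
    proof -
      have "a * GL_act (inv_into UNIV g) (lin_subst w (monomial v)) \<in> P"
        using a by (simp add: A_def GL_act_lin_subst[OF GL_inv[OF g]])
      then have "GL_act g (a * GL_act (inv_into UNIV g) (lin_subst w (monomial v))) \<in> P"
        by (rule gP[OF g])
      then show ?thesis by (simp add: GL_act_mult inv[OF g])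
    qed
    then show "GL_act g a \<in> A" by (simp add: A_def)
  qed (use idP in \<open>auto simp: A_def distrib_right mult.assoc\<close>)
  have stB: "GL_stable_ideal B"
    unfolding GL_stable_ideal_def ideal_poly_ring_iff
  proof (intro conjI ballI allI)
    fix g :: "'k fin_vec \<Rightarrow> 'k fin_vec" and b assume g: "g \<in> GL" and b: "b \<in> B"
    have "a * GL_act g b \<in> P" if "a \<in> A" for a
    proof -
      have "GL_act (inv_into UNIV g) a \<in> A"
        using stA that GL_inv[OF g] by (auto simp: GL_stable_ideal_def)
      then have "GL_act g (GL_act (inv_into UNIV g) a * b) \<in> P"
        using b by (intro gP[OF g]) (auto simp: B_def)
      then show ?thesis by (simp add: GL_act_mult inv[OF g])
    qed
    then show "GL_act g b \<in> B" by (simp add: B_def)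
  qed (use idP in \<open>auto simp: B_def distrib_left mult.left_commute\<close>)
  have "ideal_prod poly_ring A B \<subseteq> P"
  proof
    fix s assume "s \<in> ideal_prod poly_ring A B"
    then show "s \<in> P"
      by (induction rule: ideal_prod.induct)
         (auto simp: ring_of_type_algebra_def B_def intro: idP)
  qed
  then have "A \<subseteq> P \<or> B \<subseteq> P" using P stA stB by (auto simp: GL_prime_def)
  moreover have "monomial u \<in> A"
  proof -
    have "monomial u * lin_subst w (monomial v) \<in> P" for w
    proof -
      define w' where "w' i = (if i \<in> Poly_Mapping.keys u then basis_vec i else w i)" for i
      have "lin_subst w' (monomial u) = monomial u"
        unfolding lin_subst_monomial by (subst monomial_eq_prod) (auto simp: w'_def intro!: prod.cong)
      moreover have "lin_subst w' (monomial v) = lin_subst w (monomial v)"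
        unfolding lin_subst_monomial using disj by (auto simp: w'_def intro!: prod.cong)
      ultimately show ?thesis
        using GL_stable_lin_subst[OF inf stP uv, of w'] by (simp add: monomial_add lin_subst_mult)
    qed
    then show ?thesis by (simp add: A_def)
  qed
  moreover have "monomial v \<in> B"
    unfolding B_def
  proof safe
    fix a assume "a \<in> A"
    then have "a * lin_subst basis_vec (monomial v) \<in> P" unfolding A_def by blast
    then show "a * monomial v \<in> P" by (simp add: lin_subst_basis)
  qed
  ultimately show ?thesis by blast
qed

lemma GL_prime_one_notin:
  assumes "GL_prime P"
  shows "1 \<notin> P"
proof
  assume "1 \<in> P"
  moreover have "h * f \<in> P" if "f \<in> P" for f h
    using assms that by (auto simp: GL_prime_def GL_stable_ideal_def ideal_poly_ring_iff)
  ultimately have "h \<in> P" for h by (metis mult.right_neutral)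
  then show False using assms by (auto simp: GL_prime_def)
qed

lemma GL_prime_pure_power:
  fixes P :: "'k::field inf_poly set"
  assumes inf: "infinite (UNIV :: 'k set)" and P: "GL_prime P" and m: "monomial m \<in> P"
  shows "\<exists>i\<in>Poly_Mapping.keys m. Var i ^ Poly_Mapping.lookup m i \<in> P"
  using m
proof (induction "card (Poly_Mapping.keys m)" arbitrary: m rule: less_induct)
  case less
  show ?case
  proof (cases "m = 0")
    case True
    then show ?thesis using less.prems GL_prime_one_notin[OF P] by simp
  next
    case False
    then obtain i where i: "i \<in> Poly_Mapping.keys m" by (metis ex_in_conv keys_eq_empty)
    let ?s = "Poly_Mapping.single i (Poly_Mapping.lookup m i)"
    define n where "n = m - ?s"
    have ln: "Poly_Mapping.lookup n j = (if j = i then 0 else Poly_Mapping.lookup m j)" for j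
      by (simp add: n_def lookup_minus lookup_single when_def)
    have kn: "Poly_Mapping.keys n = Poly_Mapping.keys m - {i}"
      by (auto simp: in_keys_iff ln split: if_splits)
    have "?s + n = m"
      by (rule poly_mapping_eqI) (simp add: lookup_add ln lookup_single when_def)
    moreover have "Poly_Mapping.keys ?s \<inter> Poly_Mapping.keys n = {}" by (auto simp: kn)
    ultimately consider "monomial ?s \<in> P" | "monomial n \<in> P"
      using GL_prime_disjoint_monomials[OF inf P, of ?s n] less.prems by auto
    then show ?thesis
    proof cases
      case 1
      then show ?thesis using i by (auto simp: Var_power)
    next
      case 2
      have "card (Poly_Mapping.keys n) < card (Poly_Mapping.keys m)"
        unfolding kn using i by (intro psubset_card_mono) auto
      then obtain j where "j \<in> Poly_Mapping.keys n" "Var j ^ Poly_Mapping.lookup n j \<in> P"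
        using less.hyps 2 by blast
      then show ?thesis using kn by (auto simp: ln)
    qed
  qed
qed

text \<open>
  The ideal generated by the \<open>d\<close>-th powers of the variables, described by the monomials in it.
\<close>

definition high_exponent_ideal :: "nat \<Rightarrow> 'k::field inf_poly set" where
  "high_exponent_ideal d = {f. \<forall>m\<in>Poly_Mapping.keys f. \<exists>i. d \<le> Poly_Mapping.lookup m i}"

lemma ideal_high_exponent_ideal:
  "ideal (high_exponent_ideal d) (poly_ring :: 'k::field inf_poly ring)"
  unfolding ideal_poly_ring_iff
proof (intro conjI ballI allI)
  fix f g :: "'k inf_poly" assume "f \<in> high_exponent_ideal d" "g \<in> high_exponent_ideal d"
  then show "f + g \<in> high_exponent_ideal d"
    using Poly_Mapping.keys_add[of f g] by (fastforce simp: high_exponent_ideal_def)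
next
  fix f h :: "'k inf_poly" assume "f \<in> high_exponent_ideal d"
  then show "h * f \<in> high_exponent_ideal d"
    using keys_mult[of h f] by (fastforce simp: high_exponent_ideal_def lookup_add intro: trans_le_add2)
qed (simp add: high_exponent_ideal_def)

lemma monomial_in_high_exponent_ideal:
  "monomial m \<in> (high_exponent_ideal d :: 'k::field inf_poly set) \<longleftrightarrow> (\<exists>i. d \<le> Poly_Mapping.lookup m i)"
  by (simp add: high_exponent_ideal_def)

lemma high_exponent_ideal_subset:
  assumes I: "ideal I (poly_ring :: 'k::field inf_poly ring)" and "\<And>i. Var i ^ d \<in> I"
  shows "high_exponent_ideal d \<subseteq> I"
proof
  fix f :: "'k inf_poly" assume f: "f \<in> high_exponent_ideal d"
  show "f \<in> I"
  proof (rule ideal_monomials[OF I])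
    fix m assume "m \<in> Poly_Mapping.keys f"
    then obtain i where "d \<le> Poly_Mapping.lookup m i"
      using f by (auto simp: high_exponent_ideal_def)
    then have "(m - Poly_Mapping.single i d) + Poly_Mapping.single i d = m"
      by (intro poly_mapping_eqI) (auto simp: lookup_add lookup_minus lookup_single when_def)
    then have "monomial m = monomial (m - Poly_Mapping.single i d) * (Var i ^ d :: 'k inf_poly)"
      by (metis monomial_add Var_power)
    then show "monomial m \<in> I" using I assms(2)[of i] by (simp add: ideal_poly_ring_iff)
  qed
qed

lemma Var_power_in_high_exponent_ideal: "Var i ^ d \<in> high_exponent_ideal d"
  unfolding Var_power monomial_in_high_exponent_ideal by (rule exI[of _ i]) simp

lemma frobenius_power_max_ideal_eq: "frobenius_power_max_ideal d = high_exponent_ideal d"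
proof -
  interpret ring "poly_ring :: 'a inf_poly ring" by (rule ring_from_type_algebra)
  have c: "range (\<lambda>i. Var i ^ d) \<subseteq> carrier (poly_ring :: 'a inf_poly ring)"
    by (simp add: ring_of_type_algebra_def)
  show ?thesis
    unfolding frobenius_power_max_ideal_def
  proof (rule antisym)
    show "genideal poly_ring (range (\<lambda>i. Var i ^ d)) \<subseteq> (high_exponent_ideal d :: 'a inf_poly set)"
      by (rule genideal_minimal) (auto simp: ideal_high_exponent_ideal Var_power_in_high_exponent_ideal)
    show "high_exponent_ideal d \<subseteq> genideal (poly_ring :: 'a inf_poly ring) (range (\<lambda>i. Var i ^ d))"
      by (rule high_exponent_ideal_subset) (use genideal_ideal[OF c] genideal_self[OF c] in auto)
  qed
qed

text \<open>
  The exponent \<open>d\<close> is the least one for which the powers of the variables lie in \<open>P\<close>; the choice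
  of variable is immaterial because linear substitutions rename variables.
\<close>

lemma GL_prime_eq_high_exponent_ideal:
  fixes P :: "'k::field inf_poly set"
  assumes inf: "infinite (UNIV :: 'k set)" and P: "GL_prime P" and "P \<noteq> {0}"
  obtains d where "d > 0" "P = high_exponent_ideal d"
proof -
  have stP: "GL_stable_ideal P" and idP: "ideal P poly_ring"
    using P by (auto simp: GL_prime_def GL_stable_ideal_def)
  have move: "Var j ^ n \<in> P" if "Var i ^ n \<in> P" for i j n
    using GL_stable_lin_subst[OF inf stP that, of "\<lambda>_. basis_vec j"]
    by (simp add: lin_subst_power lin_subst_Var)
  have pure: "\<exists>i. Var 0 ^ Poly_Mapping.lookup m i \<in> P" if "f \<in> P" "m \<in> Poly_Mapping.keys f" for f m
    using GL_prime_pure_power[OF inf P GL_stable_monomial[OF inf stP that]] move by blast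
  obtain f where "f \<in> P" "f \<noteq> 0" using \<open>P \<noteq> {0}\<close> idP by (auto simp: ideal_poly_ring_iff)
  then have ex: "\<exists>n. Var 0 ^ n \<in> P" using pure by (metis ex_in_conv keys_eq_empty)
  define d where "d = (LEAST n. Var 0 ^ n \<in> P)"
  have d: "Var 0 ^ d \<in> P" unfolding d_def using ex by (metis LeastI)
  have "d > 0"
  proof (rule ccontr)
    assume "\<not> d > 0"
    then show False using d GL_prime_one_notin[OF P] by simp
  qed
  moreover have "P \<subseteq> high_exponent_ideal d"
  proof
    fix f assume f: "f \<in> P"
    show "f \<in> high_exponent_ideal d"
      unfolding high_exponent_ideal_def
    proof (intro CollectI ballI)
      fix m assume "m \<in> Poly_Mapping.keys f"
      then obtain i where "Var 0 ^ Poly_Mapping.lookup m i \<in> P" using pure f by blast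
      then show "\<exists>i. d \<le> Poly_Mapping.lookup m i" unfolding d_def by (metis Least_le)
    qed
  qed
  moreover have "high_exponent_ideal d \<subseteq> P"
    by (rule high_exponent_ideal_subset[OF idP]) (rule move[OF d])
  ultimately show ?thesis using that by blast
qed

section \<open>Characteristic \<open>p\<close>\<close>

lemma CHAR_inf_poly: "CHAR('k::field inf_poly) = CHAR('k)"
proof (rule CHAR_eqI)
  show "of_nat CHAR('k) = (0 :: 'k inf_poly)"
    by (simp add: single_of_nat[symmetric] del: single_of_nat)
next
  fix n assume "of_nat n = (0 :: 'k inf_poly)"
  then have "Poly_Mapping.lookup (Poly_Mapping.single 0 (of_nat n) :: 'k inf_poly) 0 = 0" by simp
  then show "CHAR('k) dvd n" by (simp add: of_nat_eq_0_iff_char_dvd del: single_of_nat)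
qed

text \<open>
  With \<open>d = m q\<close>, \<open>q\<close> a power of \<open>p\<close> and \<open>p\<close> not dividing \<open>m\<close>, the polynomial
  \<open>(x + y)\<^sup>d = (x\<^sup>q + y\<^sup>q)\<^sup>m\<close> has a term with exponents \<open>q\<close> and \<open>q(m - 1)\<close>, too small if \<open>m > 1\<close>.
\<close>

lemma exponent_is_prime_power:
  fixes p :: nat
  assumes p: "CHAR('k::field) = p" "p > 0" and inf: "infinite (UNIV :: 'k set)"
    and st: "GL_stable_ideal (high_exponent_ideal d :: 'k inf_poly set)" and "d > 0"
  obtains r where "d = p ^ r"
proof -
  have pr: "Factorial_Ring.prime p" using prime_CHAR_semidom[where ?'a = 'k] p by simp
  then obtain r m where m: "\<not> p dvd m" "d = m * p ^ r"
    using prime_power_canonical[OF pr \<open>d > 0\<close>] by blast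
  define q where "q = p ^ r"
  have "m = 1"
  proof (rule ccontr)
    assume "m \<noteq> 1"
    with m \<open>d > 0\<close> have "m \<ge> 2" by (cases m) auto
    have "q > 0" using p by (simp add: q_def)
    define n :: "nat \<Rightarrow> nat \<Rightarrow>\<^sub>0 nat" where
      "n k = Poly_Mapping.single 0 (q * k) + Poly_Mapping.single 1 (q * (m - k))" for k
    define x y :: "'k inf_poly" where "x = Var 0" and "y = Var 1"
    have "lin_subst (\<lambda>_. basis_vec 0 + basis_vec 1) (Var 0 ^ d :: 'k inf_poly) \<in> high_exponent_ideal d"
      by (rule GL_stable_lin_subst[OF inf st Var_power_in_high_exponent_ideal])
    then have "(x + y) ^ d \<in> high_exponent_ideal d"
      by (simp add: lin_subst_power lin_subst_Var linear_form_add x_def y_def)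
    also have "(x + y) ^ d = ((x + y) ^ q) ^ m"
      by (simp add: m q_def mult.commute flip: power_mult)
    also have "(x + y) ^ q = x ^ q + y ^ q"
      by (rule freshmans_dream') (simp_all add: CHAR_inf_poly p pr q_def)
    also have "(x ^ q + y ^ q) ^ m = (\<Sum>k\<le>m. of_nat (m choose k) * (x ^ q) ^ k * (y ^ q) ^ (m - k))"
      by (rule binomial_ring)
    also have "\<dots> = (\<Sum>k\<le>m. Poly_Mapping.single (n k) (of_nat (m choose k)))"
    proof (intro sum.cong refl)
      fix k
      have "of_nat (m choose k) * (x ^ q) ^ k * (y ^ q) ^ (m - k) =
          of_nat (m choose k) * Var 0 ^ (q * k) * Var 1 ^ (q * (m - k))"
        by (simp only: x_def y_def power_mult)
      also have "\<dots> = Poly_Mapping.single (n k) (of_nat (m choose k))"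
        by (simp only: Var_power single_of_nat[symmetric] n_def mult_single) simp
      finally show "of_nat (m choose k) * (x ^ q) ^ k * (y ^ q) ^ (m - k) =
          Poly_Mapping.single (n k) (of_nat (m choose k))" .
    qed
    finally have "(\<Sum>k\<le>m. Poly_Mapping.single (n k) (of_nat (m choose k) :: 'k)) \<in> high_exponent_ideal d" .
    moreover have "n 1 \<in> Poly_Mapping.keys (\<Sum>k\<le>m. Poly_Mapping.single (n k) (of_nat (m choose k) :: 'k))"
    proof -
      have "n k = n 1 \<longleftrightarrow> k = 1" for k
      proof
        assume "n k = n 1"
        then have "Poly_Mapping.lookup (n k) 0 = Poly_Mapping.lookup (n 1) 0" by simp
        then show "k = 1" using \<open>q > 0\<close> by (simp add: n_def lookup_add lookup_single)
      qed simp
      then have "Poly_Mapping.lookup (\<Sum>k\<le>m. Poly_Mapping.single (n k) (of_nat (m choose k) :: 'k)) (n 1)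
          = (\<Sum>k\<le>m. if k = 1 then of_nat m else 0)"
        unfolding lookup_sum lookup_single when_def by (intro sum.cong) auto
      also have "\<dots> = of_nat m" using \<open>m \<ge> 2\<close> by simp
      also have "\<dots> \<noteq> 0" using m p by (simp add: of_nat_eq_0_iff_char_dvd)
      finally show ?thesis by (simp add: in_keys_iff)
    qed
    ultimately obtain i where "d \<le> Poly_Mapping.lookup (n 1) i"
      by (auto simp: high_exponent_ideal_def)
    moreover have "Poly_Mapping.lookup (n 1) i \<le> q * (m - 1)"
      using \<open>m \<ge> 2\<close> by (auto simp: n_def lookup_add lookup_single when_def)
    moreover have "q * (m - 1) < d" using \<open>m \<ge> 2\<close> \<open>q > 0\<close> by (simp add: m(2) flip: q_def)
    ultimately show False by simp
  qed
  then show ?thesis using that m(2) by simp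
qed

text \<open>
  The \<open>q\<close>-th power of a linear form is a linear combination of the \<open>x\<^sub>j\<^sup>q\<close>, so the generators are
  mapped into the ideal.
\<close>

lemma GL_stable_high_exponent_ideal:
  fixes p :: nat
  assumes p: "CHAR('k::field) = p" "p > 0"
  shows "GL_stable_ideal (high_exponent_ideal (p ^ r) :: 'k inf_poly set)"
  unfolding GL_stable_ideal_def
proof (intro conjI ballI ideal_high_exponent_ideal)
  let ?H = "high_exponent_ideal (p ^ r) :: 'k inf_poly set"
  fix g :: "'k fin_vec \<Rightarrow> 'k fin_vec" and f assume f: "f \<in> ?H"
  note H = ideal_high_exponent_ideal[of "p ^ r", where ?'k = 'k]
  have pr: "Factorial_Ring.prime p" using prime_CHAR_semidom[where ?'a = 'k] p by simp
  define L where "L i = linear_form (g (basis_vec i))" for i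
  have "L i ^ (p ^ r) \<in> ?H" for i
  proof -
    have "L i ^ (p ^ r) = (\<Sum>j\<in>Poly_Mapping.keys (g (basis_vec i)).
        (Const (Poly_Mapping.lookup (g (basis_vec i)) j) * Var j) ^ (p ^ r))"
      unfolding L_def linear_form_def
      by (rule freshmans_dream_sum') (simp_all add: CHAR_inf_poly p pr)
    also have "\<dots> \<in> ?H"
      using H
      by (intro ideal_sum[OF H])
         (simp add: power_mult_distrib ideal_poly_ring_iff Var_power_in_high_exponent_ideal)
    finally show ?thesis .
  qed
  then have "high_exponent_ideal (p ^ r) \<subseteq> {f. GL_act g f \<in> ?H}"
    using H
    by (intro high_exponent_ideal_subset)
       (simp_all add: ideal_poly_ring_iff GL_act_eq_lin_subst lin_subst_0 lin_subst_add
          lin_subst_mult lin_subst_power lin_subst_Var L_def)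
  then show "GL_act g f \<in> ?H" using f by blast
qed

section \<open>Separating variables\<close>

definition shift :: "nat \<Rightarrow> (nat \<Rightarrow>\<^sub>0 nat) \<Rightarrow> (nat \<Rightarrow>\<^sub>0 nat)" where
  "shift N v = (\<Sum>i\<in>Poly_Mapping.keys v. Poly_Mapping.single (N + i) (Poly_Mapping.lookup v i))"

lemma lookup_shift:
  "Poly_Mapping.lookup (shift N v) j = (if N \<le> j then Poly_Mapping.lookup v (j - N) else 0)"
proof -
  have "Poly_Mapping.lookup (shift N v) j =
      (\<Sum>i\<in>Poly_Mapping.keys v. if i = j - N \<and> N \<le> j then Poly_Mapping.lookup v i else 0)"
    unfolding shift_def lookup_sum lookup_single when_def by (intro sum.cong) auto
  then show ?thesis by (cases "N \<le> j") (auto simp: in_keys_iff)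
qed

lemma GL_stable_shift:
  fixes B :: "'k::field inf_poly set"
  assumes "infinite (UNIV :: 'k set)" "GL_stable_ideal B" "monomial v \<in> B"
  shows "monomial (shift N v) \<in> B"
proof -
  have "(\<Prod>i\<in>A. monomial (h i)) = (monomial (\<Sum>i\<in>A. h i) :: 'k inf_poly)"
    for A and h :: "nat \<Rightarrow> nat \<Rightarrow>\<^sub>0 nat"
    by (induction A rule: infinite_finite_induct) (simp_all add: mult_single)
  then have "lin_subst (\<lambda>i. basis_vec (N + i)) (monomial v) = (monomial (shift N v) :: 'k inf_poly)"
    by (simp add: lin_subst_monomial Var_power shift_def)
  then show ?thesis using GL_stable_lin_subst[OF assms, of "\<lambda>i. basis_vec (N + i)"] by simp
qed

text \<open>
  Stable ideals are spanned by monomials, so primality can be tested on two monomials, and stability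
  allows the second to be moved to variables that do not occur in the first.
\<close>

lemma GL_primeI:
  fixes P :: "'k::field inf_poly set"
  assumes inf: "infinite (UNIV :: 'k set)" and st: "GL_stable_ideal P" and "P \<noteq> UNIV"
    and sep: "\<And>u v N. monomial u \<notin> P \<Longrightarrow> monomial v \<notin> P \<Longrightarrow> Poly_Mapping.keys u \<subseteq> {..<N} \<Longrightarrow>
      monomial (u + shift N v) \<notin> P"
  shows "GL_prime P"
  unfolding GL_prime_def
proof (intro conjI allI impI st \<open>P \<noteq> UNIV\<close>)
  fix A B :: "'k inf_poly set"
  assume A: "GL_stable_ideal A" and B: "GL_stable_ideal B" and AB: "ideal_prod poly_ring A B \<subseteq> P"
  have mono: "\<exists>u. monomial u \<in> I \<and> monomial u \<notin> P" if "GL_stable_ideal I" "\<not> I \<subseteq> P" for I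
    using that ideal_monomials[of P] GL_stable_monomial[OF inf that(1)] st
    unfolding GL_stable_ideal_def by blast
  show "A \<subseteq> P \<or> B \<subseteq> P"
  proof (rule ccontr)
    assume "\<not> (A \<subseteq> P \<or> B \<subseteq> P)"
    then obtain u v where u: "monomial u \<in> A" "monomial u \<notin> P" and v: "monomial v \<in> B" "monomial v \<notin> P"
      using mono A B by metis
    obtain N where N: "Poly_Mapping.keys u \<subseteq> {..<N}"
      using finite_nat_iff_bounded[of "Poly_Mapping.keys u"] by auto
    have "monomial u * monomial (shift N v) \<in> ideal_prod poly_ring A B"
      using ideal_prod.prod[OF u(1) GL_stable_shift[OF inf B v(1)], of poly_ring N]
      by (simp add: ring_of_type_algebra_def)
    then show False using AB sep[OF u(2) v(2) N] by (auto simp: monomial_add)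
  qed
qed

theorem theorem1:
  fixes p :: nat
  assumes "infinite (UNIV :: 'k::field set)"
    and "CHAR('k) = p" and "p > 0"
  shows "{P :: 'k inf_poly set. GL_prime P} = {{0}} \<union>
    {frobenius_power_max_ideal (p ^ r) | r :: nat. True}"
proof (intro equalityI subsetI)
  fix P :: "'k inf_poly set" assume "P \<in> {P. GL_prime P}"
  then have P: "GL_prime P" by simp
  show "P \<in> {{0}} \<union> {frobenius_power_max_ideal (p ^ r) | r :: nat. True}"
  proof (cases "P = {0}")
    case False
    then obtain d where d: "d > 0" "P = high_exponent_ideal d"
      using GL_prime_eq_high_exponent_ideal[OF assms(1) P] by metis
    then obtain r where "d = p ^ r"
      using exponent_is_prime_power[OF assms(2,3,1), of d] P by (auto simp: GL_prime_def)
    then show ?thesis using d by (auto simp: frobenius_power_max_ideal_eq)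
  qed simp
next
  fix P :: "'k inf_poly set"
  assume "P \<in> {{0}} \<union> {frobenius_power_max_ideal (p ^ r) | r :: nat. True}"
  then consider "P = {0}" | r where "P = high_exponent_ideal (p ^ r)"
    by (auto simp: frobenius_power_max_ideal_eq)
  then show "P \<in> {P. GL_prime P}"
  proof cases
    case 1
    have "GL_prime ({0} :: 'k inf_poly set)"
    proof (rule GL_primeI[OF assms(1)])
      show "GL_stable_ideal ({0} :: 'k inf_poly set)"
        by (simp add: GL_stable_ideal_def ideal_poly_ring_iff GL_act_def)
      show "{0} \<noteq> (UNIV :: 'k inf_poly set)" by (metis UNIV_I singletonD zero_neq_one)
    qed (simp add: monomial_nonzero)
    then show ?thesis using 1 by simp
  next
    case 2
    have "GL_prime (high_exponent_ideal (p ^ r) :: 'k inf_poly set)"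
    proof (rule GL_primeI[OF assms(1)])
      show "GL_stable_ideal (high_exponent_ideal (p ^ r) :: 'k inf_poly set)"
        by (rule GL_stable_high_exponent_ideal[OF assms(2,3)])
      have "(monomial 0 :: 'k inf_poly) \<notin> high_exponent_ideal (p ^ r)"
        unfolding monomial_in_high_exponent_ideal using assms(3) by simp
      then show "high_exponent_ideal (p ^ r) \<noteq> (UNIV :: 'k inf_poly set)" by blast
    next
      fix u v N
      assume "(monomial u :: 'k inf_poly) \<notin> high_exponent_ideal (p ^ r)"
        "(monomial v :: 'k inf_poly) \<notin> high_exponent_ideal (p ^ r)"
        and N: "Poly_Mapping.keys u \<subseteq> {..<N}"
      then have low: "Poly_Mapping.lookup u i < p ^ r" "Poly_Mapping.lookup v i < p ^ r" for i
        by (auto simp: monomial_in_high_exponent_ideal not_le)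
      have "Poly_Mapping.lookup u j = 0" if "N \<le> j" for j
        using N that by (auto simp: in_keys_iff)
      then have "Poly_Mapping.lookup (u + shift N v) j < p ^ r" for j
        using low by (simp add: lookup_add lookup_shift)
      then show "(monomial (u + shift N v) :: 'k inf_poly) \<notin> high_exponent_ideal (p ^ r)"
        by (auto simp: monomial_in_high_exponent_ideal not_le)
    qed
    then show ?thesis using 2 by simp
  qed
qed

end
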